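(* For all integers $m\ge0$ and $r\ge0$, $$\langle W|\mathsf d^{m+r}|V^r\rangle=\begin{bmatrix}m+r\\ r\end{bmatrix}_q\frac{F_m(bdq^r)}{\prod_{i=0}^{m-1}(1-abcdq^{2r+i})},$$ where $F_m(y)$ is defined by $F_0(y)=1$, $F_m(y)=0$ for $m<0$, and $F_m(y)=\big(b+d-y(a+c)q^{m-1}\big)F_{m-1}(y)+(q^{m-1}-1)\big(bd-acq^{m-2}y^2\big)F_{m-2}(y)$ for $m>0$.
   Context: Fix generic complex parameters $a,b,c,d,q$. For integers $n\ge0$ define $\mathcal{A}_n=\frac{(1-q^{n-1}abcd)(1-q^{n+1})(1-q^nab)(1-q^nac)(1-q^nad)(1-q^nbc)(1-q^nbd)(1-q^ncd)}{(1-q^{2n-1}abcd)(1-q^{2n}abcd)^2(1-q^{2n+1}abcd)}$, $d_n^\natural=\frac{q^{n-1}}{(1-q^{2n-2}abcd)(1-q^{2n}abcd)}\big[bd(a+c)+(b+d)q-abcd(b+d)q^{n-1}-\{bd(a+c)+abcd(b+d)\}q^n-bd(a+c)q^{n+1}+ab^2cd^2(a+c)q^{2n-1}+abcd(b+d)q^{2n}\big]$, $d_n^\sharp=1$, $d_n^\flat=-\frac{q^nbd}{(1-q^nac)(1-q^nbd)}\mathcal{A}_n$. Let $\mathsf d$ be the infinite tridiagonal matrix indexed by $\{0,1,\dots\}$ with nonzero entries $\mathsf d_{n,n}=d_n^\natural$, $\mathsf d_{n,n+1}=d_n^\sharp$, $\mathsf d_{n+1,n}=d_n^\flat$. Let $\langle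 W|=(1,0,0,\dots)$ and $|V^r\rangle$ the column vector with $1$ in position $r$ (positions indexed from $0$) and $0$ elsewhere. The $q$-binomial coefficient is $\begin{bmatrix}N\\ r\end{bmatrix}_q=\frac{[N]_q!}{[r]_q![N-r]_q!}$ with $[k]_q!=\prod_{j=1}^k(1+q+\dots+q^{j-1})$. *)

theory Defs
  imports Complex_Main
begin

type_synonym inf_matrix = "nat \<Rightarrow> nat \<Rightarrow> complex"
type_synonym inf_vector = "nat \<Rightarrow> complex"

(* The infinite sums below have finite support for the banded matrices and
   finitely supported vectors to which they are applied. *)

definition mat_mult :: "inf_matrix \<Rightarrow> inf_matrix \<Rightarrow> inf_matrix" where
  "mat_mult A B = (\<lambda>i j. \<Sum>k. A i k * B k j)"

primrec mat_power :: "inf_matrix \<Rightarrow> nat \<Rightarrow> inf_matrix" where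
  "mat_power A 0 = (\<lambda>i j. if i = j then 1 else 0)"
| "mat_power A (Suc n) = mat_mult (mat_power A n) A"

definition bra_mat_ket :: "inf_vector \<Rightarrow> inf_matrix \<Rightarrow> inf_vector \<Rightarrow> complex" where
  "bra_mat_ket w A v = (\<Sum>i. \<Sum>j. w i * A i j * v j)"

definition bra_W :: inf_vector where
  "bra_W = (\<lambda>i. if i = 0 then 1 else 0)"

definition ket_V :: "nat \<Rightarrow> inf_vector" where
  "ket_V r = (\<lambda>j. if j = r then 1 else 0)"

(* Integer exponents are used where the exponent is negative at n = 0. *)

definition A_coeff :: "complex \<Rightarrow> complex \<Rightarrow> complex \<Rightarrow> complex \<Rightarrow> complex \<Rightarrow> nat \<Rightarrow> complex" where
  "A_coeff a b c d q n =
    ((1 - q powi (int n - 1) * (a*b*c*d)) * (1 - q^(n+1))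
      * (1 - q^n * (a*b)) * (1 - q^n * (a*c)) * (1 - q^n * (a*d))
      * (1 - q^n * (b*c)) * (1 - q^n * (b*d)) * (1 - q^n * (c*d)))
    / ((1 - q powi (2 * int n - 1) * (a*b*c*d)) * (1 - q^(2*n) * (a*b*c*d))^2
      * (1 - q^(2*n+1) * (a*b*c*d)))"

definition d_natural :: "complex \<Rightarrow> complex \<Rightarrow> complex \<Rightarrow> complex \<Rightarrow> complex \<Rightarrow> nat \<Rightarrow> complex" where
  "d_natural a b c d q n =
    q powi (int n - 1)
    / ((1 - q powi (2 * int n - 2) * (a*b*c*d)) * (1 - q^(2*n) * (a*b*c*d)))
    * (b*d*(a+c) + (b+d)*q - a*b*c*d*(b+d) * q powi (int n - 1)
       - (b*d*(a+c) + a*b*c*d*(b+d)) * q^n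
       - b*d*(a+c) * q^(n+1)
       + a*b^2*c*d^2*(a+c) * q powi (2 * int n - 1)
       + a*b*c*d*(b+d) * q^(2*n))"

definition d_sharp :: "nat \<Rightarrow> complex" where
  "d_sharp n = 1"

definition d_flat :: "complex \<Rightarrow> complex \<Rightarrow> complex \<Rightarrow> complex \<Rightarrow> complex \<Rightarrow> nat \<Rightarrow> complex" where
  "d_flat a b c d q n =
    - (q^n * (b*d) / ((1 - q^n * (a*c)) * (1 - q^n * (b*d)))) * A_coeff a b c d q n"

definition d_matrix :: "complex \<Rightarrow> complex \<Rightarrow> complex \<Rightarrow> complex \<Rightarrow> complex \<Rightarrow> inf_matrix" where
  "d_matrix a b c d q = (\<lambda>i j.
     if j = i then d_natural a b c d q i
     else if j = i + 1 then d_sharp i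
     else if i = j + 1 then d_flat a b c d q j
     else 0)"

definition q_int :: "complex \<Rightarrow> nat \<Rightarrow> complex" where
  "q_int q j = (\<Sum>i<j. q^i)"

definition q_fact :: "complex \<Rightarrow> nat \<Rightarrow> complex" where
  "q_fact q k = (\<Prod>j=1..k. q_int q j)"

definition q_binomial :: "complex \<Rightarrow> nat \<Rightarrow> nat \<Rightarrow> complex" where
  "q_binomial q N r = q_fact q N / (q_fact q r * q_fact q (N - r))"

function F_poly :: "complex \<Rightarrow> complex \<Rightarrow> complex \<Rightarrow> complex \<Rightarrow> complex \<Rightarrow> int \<Rightarrow> complex \<Rightarrow> complex" where
  "F_poly a b c d q m y =
    (if m < 0 then 0
     else if m = 0 then 1
     else (b + d - y * (a+c) * q powi (m-1)) * F_poly a b c d q (m-1) y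
        + (q powi (m-1) - 1) * (b*d - a*c * q powi (m-2) * y^2) * F_poly a b c d q (m-2) y)"
  by pat_completeness auto
termination
  by (relation "measure (\<lambda>(a, b, c, d, q, m, y). nat m)") auto

declare F_poly.simps [simp del]

end

theory Submission
  imports Defs
begin

text \<open>
  Expanding \<open>\<langle>W| d\<^bsup>N+1\<^esup> |V\<^sup>r\<rangle>\<close> along the last factor gives a recurrence in
  \<open>N\<close> and \<open>r\<close> that determines these numbers, so it suffices to show that the closed form
  satisfies it. The generating function of \<open>F\<^sub>m(y) / (q;q)\<^sub>m\<close> is
  \<open>H\<^sub>y(t) = (ayt, cyt; q)\<^sub>\<infinity> / (bt, dt; q)\<^sub>\<infinity>\<close>, whence
  \<open>H\<^sub>y(t) = (1 - ayt)(1 - cyt) H\<^bsub>yq\<^esub>(t)\<close> and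
  \<open>H\<^sub>y(qt) = (1 - bt)(1 - dt) H\<^bsub>yq\<^esub>(t)\<close>. Linear combinations of these two relations
  express \<open>F\<^sub>m(y)\<close> and \<open>F\<^bsub>m+1\<^esub>(y)\<close> through \<open>F\<^sub>m(yq)\<close> and \<open>F\<^bsub>m-1\<^esub>(yq)\<close>; substituting
  them at \<open>y = bdq\<^sup>r\<close> and at \<open>y = bdq\<^bsup>r-1\<^esup>\<close> reduces the recurrence to two polynomial
  identities free of \<open>m\<close>.
\<close>

section \<open>The polynomials \<open>F\<^sub>m\<close>\<close>

lemma F_poly_0 [simp]: "F_poly a b c d q 0 y = 1"
  by (simp add: F_poly.simps)

(* For m = 0 the factor 1 - q^m annihilates the term with truncated index m - 1. *)
lemma F_poly_Suc:
  "F_poly a b c d q (int (Suc m)) y =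
    (b + d - y * (a + c) * q ^ m) * F_poly a b c d q (int m) y
    - (1 - q ^ m) * (b * d - a * c * q ^ (m - 1) * y\<^sup>2) * F_poly a b c d q (int (m - 1)) y"
proof (cases m)
  case 0
  then show ?thesis by (simp add: F_poly.simps[of a b c d q 1] F_poly.simps[of a b c d q "-1"])
next
  case (Suc n)
  have e: "int (Suc (Suc n)) - 1 = int (Suc n)" "int (Suc (Suc n)) - 2 = int n"
    by simp_all
  show ?thesis
    unfolding Suc
    by (subst F_poly.simps) (simp only: e power_int_of_nat, simp add: algebra_simps del: of_nat_Suc)
qed

lemma F_poly_shift:
  fixes a b c d q s :: complex
  defines "F \<equiv> \<lambda>m::nat. F_poly a b c d q (int m) (b * d * s)"
    and "U \<equiv> \<lambda>m::nat. F_poly a b c d q (int m) (b * d * s * q)"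
    and "x \<equiv> a * b * c * d * s\<^sup>2"
  shows F_poly_shift_Suc: "F (Suc m) = (b + d - (a + c) * (b * d * s)) * U m
      - b * d * (1 - x) * (1 - q ^ m) * U (m - 1)" (is "?P m")
    and F_poly_shift_same: "(1 - x * q ^ m) * F m = (1 - x) * U m
      - ((a + c) * (b * d * s) - (b + d) * x) * (1 - q ^ m) * U (m - 1)" (is "?Q m")
proof -
  have F0: "F 0 = 1" and U0: "U 0 = 1" by (simp_all add: F_def U_def)
  have F_rec: "F (Suc m) = (b + d - b * d * s * (a + c) * q ^ m) * F m
      - (1 - q ^ m) * (b * d * (1 - x * q ^ (m - 1))) * F (m - 1)" for m
    unfolding F_def x_def F_poly_Suc by (simp add: algebra_simps power2_eq_square)
  have U_rec: "U (Suc m) = (b + d - b * d * s * (a + c) * q ^ Suc m) * U m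
      - (1 - q ^ m) * (b * d * (1 - x * q ^ Suc m)) * U (m - 1)" for m
    unfolding U_def x_def F_poly_Suc
    by (cases m) (simp_all add: algebra_simps power2_eq_square)
  have "?P m \<and> ?Q m"
  proof (induction m)
    case 0
    show ?case using F_rec[of 0] by (simp add: F0 U0 algebra_simps)
  next
    case (Suc m)
    then have P: "?P m" and Q: "?Q m" by auto
    have "F (Suc (Suc m)) = (b + d - b * d * s * (a + c) * q ^ Suc m) * F (Suc m)
      - (1 - q ^ Suc m) * (b * d) * ((1 - x * q ^ m) * F m)"
      using F_rec[of "Suc m"] by simp
    also have "\<dots> = (b + d - (a + c) * (b * d * s)) * U (Suc m)
      - b * d * (1 - x) * (1 - q ^ Suc m) * U (Suc m - 1)"
      unfolding P Q U_rec power_Suc diff_Suc_1 by (simp only: x_def) algebra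
    finally have P': "?P (Suc m)" .
    have Q': "?Q (Suc m)"
      unfolding P U_rec power_Suc diff_Suc_1 by (simp only: x_def) algebra
    from P' Q' show ?case ..
  qed
  then show "?P m" "?Q m" by auto
qed

section \<open>\<open>q\<close>-integers and \<open>q\<close>-binomial coefficients\<close>

lemma q_int_mult: "(1 - q) * q_int q n = 1 - q ^ n"
  unfolding q_int_def by (simp add: one_diff_power_eq)

lemma q_int_add: "q_int q (m + n) = q_int q m + q ^ m * q_int q n"
  by (induction n) (simp_all add: q_int_def algebra_simps power_add)

lemma q_int_cross: "q_int q m * (1 - q ^ n) = q_int q n * (1 - q ^ m)"
  by (simp flip: q_int_mult)

lemma q_fact_Suc: "q_fact q (Suc n) = q_int q (Suc n) * q_fact q n"
  by (simp add: q_fact_def mult.commute)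

lemma q_fact_nonzero:
  assumes "\<And>j. j \<ge> 1 \<Longrightarrow> q_int q j \<noteq> 0"
  shows "q_fact q n \<noteq> 0"
  using assms by (simp add: q_fact_def)

lemma q_binomial_self:
  assumes "\<And>j. j \<ge> 1 \<Longrightarrow> q_int q j \<noteq> 0"
  shows "q_binomial q n n = 1"
  using q_fact_nonzero[OF assms] by (simp add: q_binomial_def q_fact_def)

lemma q_binomial_Suc_top:
  assumes "\<And>j. j \<ge> 1 \<Longrightarrow> q_int q j \<noteq> 0"
  shows "q_binomial q (Suc m + r) r = q_binomial q (m + r) r * q_int q (Suc m + r) / q_int q (Suc m)"
  using q_fact_nonzero[OF assms] assms[of "Suc m"]
  by (simp add: q_binomial_def q_fact_Suc field_simps)

lemma q_binomial_Suc_bottom: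
  assumes "\<And>j. j \<ge> 1 \<Longrightarrow> q_int q j \<noteq> 0"
  shows "q_binomial q (Suc m + r) (Suc r) * q_int q (Suc r)
    = q_binomial q (Suc m + r) r * q_int q (Suc m)"
proof -
  have "Suc m + r - Suc r = m" "Suc m + r - r = Suc m" by auto
  then show ?thesis
    using q_fact_nonzero[OF assms] assms[of "Suc m"] assms[of "Suc r"]
    by (simp add: q_binomial_def q_fact_Suc field_simps)
qed

section \<open>The contiguous relation\<close>

lemma natural_coeff_identity:
  fixes a b c d q s :: complex
  defines "e \<equiv> a * b * c * d" and "y \<equiv> b * d * s * q"
  defines "x \<equiv> e * s\<^sup>2"
  defines "B \<equiv> b * d * (a + c) + (b + d) * q - e * (b + d) * s
      - (b * d * (a + c) + e * (b + d)) * (s * q) - b * d * (a + c) * (s * q\<^sup>2)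
      + b * d * e * (a + c) * (s\<^sup>2 * q) + e * (b + d) * (s * q)\<^sup>2"
  shows "s * B * (1 - x * q) - (1 - s * q) * ((a + c) * (b * d * s) - (b + d) * x) * (1 - x * q\<^sup>2)
    = s * q * (1 - s * e) * (b + d - (a + c) * y) * (1 - x)"
  unfolding B_def x_def y_def e_def by algebra

lemma flat_coeff_identity:
  fixes a b c d Q :: complex
  defines "y \<equiv> b * d * Q" and "x \<equiv> a * b * c * d * Q\<^sup>2"
  shows "(b + d - (a + c) * y) * ((a + c) * y - (b + d) * x)
    = b * d * (1 - x)\<^sup>2
      - b * d * ((1 - Q * (a * b)) * (1 - Q * (a * d)) * (1 - Q * (b * c)) * (1 - Q * (c * d)))"
  unfolding x_def y_def by algebra


lemma prod_shift_one:
  "(\<Prod>i<Suc m. 1 - x * q ^ i) = (1 - x) * (\<Prod>i<m. 1 - x * q * q ^ i)" for x q :: complex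
  by (simp add: prod.lessThan_Suc_shift mult.assoc del: prod.lessThan_Suc)

lemma prod_shift_two:
  fixes x q :: complex
  shows "(\<Prod>i<Suc (Suc m). 1 - x * q ^ i) = (1 - x) * (1 - x * q) * (\<Prod>i<m. 1 - x * q\<^sup>2 * q ^ i)"
  unfolding prod_shift_one by (simp only: power2_eq_square mult.assoc)

text \<open>
  With \<open>s = q\<^bsup>r-1\<^esup>\<close> all exponents become nonnegative, so that \<open>r = 0\<close> needs no separate
  treatment.
\<close>

lemma d_natural_shifted:
  fixes a b c d q :: complex and r :: nat
  assumes q: "q \<noteq> 0"
  defines "s \<equiv> q powi (int r - 1)" and "e \<equiv> a * b * c * d"
  defines "x \<equiv> e * s\<^sup>2"
  assumes nz: "1 - x \<noteq> 0" "1 - x * q \<noteq> 0" "1 - x * q\<^sup>2 \<noteq> 0"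
  shows "d_natural a b c d q r = s * q * (1 - s * e) * (b + d - (a + c) * (b * d * s * q))
      / ((1 - x * q) * (1 - x * q\<^sup>2))
    + (1 - s * q) * ((a + c) * (b * d * s) - (b + d) * x) / ((1 - x) * (1 - x * q))"
proof -
  have p1: "q ^ r = s * q"
    unfolding s_def using q by (simp add: power_int_diff)
  have p2: "q powi (2 * int r - 2) = s\<^sup>2"
    unfolding s_def using q
    by (simp add: power_int_diff power2_eq_square power_int_mult power_int_numeral field_simps)
  have p3: "q powi (2 * int r - 1) = s\<^sup>2 * q"
    using q p2 by (simp add: power_int_diff power2_eq_square field_simps)
  have p4: "q ^ (2 * r) = (s * q)\<^sup>2" by (simp add: p1 power_mult mult.commute[of 2])
  define B where "B = b * d * (a + c) + (b + d) * q - e * (b + d) * s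
      - (b * d * (a + c) + e * (b + d)) * (s * q) - b * d * (a + c) * (s * q\<^sup>2)
      + b * d * e * (a + c) * (s\<^sup>2 * q) + e * (b + d) * (s * q)\<^sup>2"
  have B: "d_natural a b c d q r = s / ((1 - x) * (1 - x * q\<^sup>2)) * B"
    unfolding d_natural_def p2 p3 p4 power_add p1 B_def x_def e_def s_def[symmetric]
    by (simp add: power2_eq_square algebra_simps)
  have "s * B * (1 - x * q) = (1 - s * q) * ((a + c) * (b * d * s) - (b + d) * x) * (1 - x * q\<^sup>2)
    + s * q * (1 - s * e) * (b + d - (a + c) * (b * d * s * q)) * (1 - x)"
    using natural_coeff_identity[of s b d a c q] unfolding B_def x_def e_def by (simp add: algebra_simps)
  then have "s * B = ((1 - s * q) * ((a + c) * (b * d * s) - (b + d) * x) * (1 - x * q\<^sup>2)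
    + s * q * (1 - s * e) * (b + d - (a + c) * (b * d * s * q)) * (1 - x)) / (1 - x * q)"
    using nz by (simp add: eq_divide_eq)
  then have "d_natural a b c d q r = ((1 - s * q) * ((a + c) * (b * d * s) - (b + d) * x) * (1 - x * q\<^sup>2)
    + s * q * (1 - s * e) * (b + d - (a + c) * (b * d * s * q)) * (1 - x))
      / (1 - x * q) / ((1 - x) * (1 - x * q\<^sup>2))"
    by (simp add: B)
  also have "\<dots> = s * q * (1 - s * e) * (b + d - (a + c) * (b * d * s * q))
      / ((1 - x * q) * (1 - x * q\<^sup>2))
    + (1 - s * q) * ((a + c) * (b * d * s) - (b + d) * x) / ((1 - x) * (1 - x * q))"
    using nz by (simp add: add_divide_distrib ac_simps)
  finally show ?thesis .
qed

lemma d_flat_shifted: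
  fixes a b c d q :: complex and r :: nat
  assumes q: "q \<noteq> 0"
  defines "s \<equiv> q powi (int r - 1)" and "e \<equiv> a * b * c * d"
  defines "x \<equiv> e * s\<^sup>2" and "y \<equiv> b * d * s * q"
  assumes nz: "1 - x * q \<noteq> 0" "1 - x * q\<^sup>2 \<noteq> 0" "1 - x * q ^ 3 \<noteq> 0"
    and ac: "1 - q ^ r * (a * c) \<noteq> 0" and bd: "1 - q ^ r * (b * d) \<noteq> 0"
  shows "d_flat a b c d q r * ((1 - x * q\<^sup>2) * (1 - x * q ^ 3)) =
    (1 - q ^ Suc r) * (s * q * (1 - s * e) / (1 - x * q)
      * ((b + d - (a + c) * y) * ((a + c) * y - (b + d) * (x * q\<^sup>2)) / (1 - x * q\<^sup>2) - b * d * (1 - x * q\<^sup>2)))"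
proof -
  define Q where "Q = q ^ r"
  have p1: "Q = s * q"
    unfolding s_def Q_def using q by (simp add: power_int_diff)
  have p2: "q powi (2 * int r - 1) = s\<^sup>2 * q"
    unfolding s_def using q
    by (simp add: power_int_diff power2_eq_square power_int_mult power_int_numeral field_simps)
  have p4: "q ^ (2 * r) = Q\<^sup>2" by (simp add: Q_def power_mult mult.commute[of 2])
  have x: "x * q\<^sup>2 = a * b * c * d * Q\<^sup>2" "x * q ^ 3 = a * b * c * d * Q\<^sup>2 * q"
    "x * q = s\<^sup>2 * q * (a * b * c * d)"
    and y: "y = b * d * Q"
    by (simp_all add: x_def e_def y_def p1 power2_eq_square power3_eq_cube)
  define T where "T = (1 - Q * (a * b)) * (1 - Q * (a * d)) * (1 - Q * (b * c)) * (1 - Q * (c * d))"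
  have A: "A_coeff a b c d q r = (1 - s * e) * (1 - q ^ Suc r) * T * ((1 - Q * (a * c)) * (1 - Q * (b * d)))
     / ((1 - x * q) * (1 - x * q\<^sup>2)\<^sup>2 * (1 - x * q ^ 3))"
    unfolding A_coeff_def T_def x p2 power_add[of q "2 * r"] p4 s_def[symmetric] e_def Q_def[symmetric]
    by (simp add: mult_ac)
  have K: "(b + d - (a + c) * y) * ((a + c) * y - (b + d) * (x * q\<^sup>2)) = b * d * (1 - x * q\<^sup>2)\<^sup>2 - b * d * T"
    unfolding x y T_def by (rule flat_coeff_identity)
  have "d_flat a b c d q r = - (Q * (b * d)) * (1 - s * e) * (1 - q ^ Suc r) * T
     / ((1 - x * q) * (1 - x * q\<^sup>2)\<^sup>2 * (1 - x * q ^ 3))"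
    unfolding d_flat_def A Q_def[symmetric] using ac bd unfolding Q_def[symmetric] by simp
  then have "d_flat a b c d q r * ((1 - x * q\<^sup>2) * (1 - x * q ^ 3))
    = - (Q * (b * d)) * (1 - s * e) * (1 - q ^ Suc r) * T / ((1 - x * q) * (1 - x * q\<^sup>2))"
    using nz by (simp add: power2_eq_square)
  also have "\<dots> = (1 - q ^ Suc r) * (Q * (1 - s * e) / (1 - x * q) * (- (b * d * T) / (1 - x * q\<^sup>2)))"
    by (simp add: mult_ac)
  also have "- (b * d * T) / (1 - x * q\<^sup>2)
    = (b * d * (1 - x * q\<^sup>2)\<^sup>2 - b * d * T) / (1 - x * q\<^sup>2) - b * d * (1 - x * q\<^sup>2)"
    using nz by (simp add: diff_divide_distrib power2_eq_square)
  finally show ?thesis unfolding K p1 .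
qed


locale generic_parameters =
  fixes a b c d q :: complex
  assumes q_nonzero: "q \<noteq> 0"
    and q_int_nonzero: "\<And>j::nat. j \<ge> 1 \<Longrightarrow> q_int q j \<noteq> 0"
    and abcd_generic: "\<And>k::int. k \<ge> -2 \<Longrightarrow> 1 - q powi k * (a*b*c*d) \<noteq> 0"
    and ac_generic: "\<And>n::nat. 1 - q^n * (a*c) \<noteq> 0"
    and bd_generic: "\<And>n::nat. 1 - q^n * (b*d) \<noteq> 0"
begin

abbreviation F :: "nat \<Rightarrow> complex \<Rightarrow> complex" where
  "F m y \<equiv> F_poly a b c d q (int m) y"

definition poch :: "nat \<Rightarrow> complex \<Rightarrow> complex" where
  "poch m x = (\<Prod>i<m. 1 - x * q ^ i)"

definition walk_sum :: "nat \<Rightarrow> nat \<Rightarrow> complex" where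
  "walk_sum m r = q_binomial q (m + r) r * F m (b * d * q ^ r) / poch m (a * b * c * d * q ^ (2 * r))"

lemma walk_sum_0: "walk_sum 0 r = 1"
  by (simp add: walk_sum_def poch_def q_binomial_self[OF q_int_nonzero])

lemma walk_sum_rec:
  "walk_sum (Suc m) r = (if r = 0 then 0 else walk_sum (Suc m) (r - 1))
    + d_natural a b c d q r * walk_sum m r
    + (if m = 0 then 0 else d_flat a b c d q r * walk_sum (m - 1) (Suc r))"
proof -
  define s where "s = q powi (int r - 1)"
  define e where "e = a * b * c * d"
  define x where "x = e * s\<^sup>2"
  define z where "z = b * d * s"
  define y where "y = b * d * s * q"
  define \<beta> where "\<beta> = b + d - (a + c) * y"
  define \<kappa> where "\<kappa> = (a + c) * z - (b + d) * x"
  define \<kappa>' where "\<kappa>' = (a + c) * y - (b + d) * (x * q\<^sup>2)"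
  define W where "W = s * q * (1 - s * e) / (1 - x * q)"
  define h where "h = \<beta> / (1 - x * q\<^sup>2)"
  define \<phi> where "\<phi> = W * (h * \<kappa>' - b * d * (1 - x * q\<^sup>2))"
  define M where "M = q_int q (Suc m)"
  define R where "R = q_int q r"
  define C where "C = q_binomial q (m + r) r"
  define D where "D = poch (Suc m) (x * q\<^sup>2)"
  define N where "N = d_natural a b c d q r"
  have sq: "q ^ r = s * q"
    unfolding s_def using q_nonzero by (simp add: power_int_diff)
  have s2: "s\<^sup>2 = q powi (2 * int r - 2)"
    unfolding s_def using q_nonzero
    by (simp add: power_int_diff power2_eq_square power_int_mult power_int_numeral field_simps)
  have nz: "1 - x * q ^ i \<noteq> 0" for i
  proof -
    have "x * q ^ i = q powi (2 * int r - 2 + int i) * (a * b * c * d)"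
      using q_nonzero by (simp add: x_def e_def s2 power_int_add mult_ac)
    with abcd_generic[of "2 * int r - 2 + int i"] show ?thesis by simp
  qed
  have nz': "1 - x \<noteq> 0" "1 - x * q \<noteq> 0" using nz[of 0] nz[of 1] by simp_all
  have nz_top: "1 - x * q\<^sup>2 * q ^ m \<noteq> 0"
    using nz[of "2 + m"] by (simp only: power_add mult.assoc not_False_eq_True)
  have M0: "M \<noteq> 0" using q_int_nonzero[of "Suc m"] by (simp add: M_def)

  have shift_z: "(1 - x * q ^ Suc m) * F (Suc m) z = (1 - x) * F (Suc m) y - \<kappa> * (1 - q ^ Suc m) * F m y"
    using F_poly_shift_same[where m = "Suc m" and s = s and a = a and b = b and c = c and d = d and q = q]
    unfolding x_def e_def z_def y_def \<kappa>_def diff_Suc_1 .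
  have x_sq: "x * q\<^sup>2 = a * b * c * d * (s * q)\<^sup>2"
    by (simp add: x_def e_def power2_eq_square mult_ac)
  have shift_y: "(1 - x * q\<^sup>2 * q ^ m) * F m y
      = (1 - x * q\<^sup>2) * F m (y * q) - \<kappa>' * (1 - q ^ m) * F (m - 1) (y * q)"
    and shift_y_Suc: "F (Suc m) y
      = \<beta> * F m (y * q) - b * d * (1 - x * q\<^sup>2) * (1 - q ^ m) * F (m - 1) (y * q)"
    using F_poly_shift_same[where m = m and s = "s * q" and a = a and b = b and c = c and d = d and q = q]
      F_poly_shift_Suc[where m = m and s = "s * q" and a = a and b = b and c = c and d = d and q = q]
    unfolding x_sq y_def \<beta>_def \<kappa>'_def by (simp_all only: mult.assoc)

  have nat: "N = W * h + (1 - s * q) * \<kappa> / ((1 - x) * (1 - x * q))"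
    unfolding N_def
    using d_natural_shifted[of q a b c d r] nz' nz[of 2] q_nonzero
    by (simp add: h_def W_def \<beta>_def \<kappa>_def y_def z_def x_def e_def s_def)
  have flat: "d_flat a b c d q r * ((1 - x * q\<^sup>2) * (1 - x * q ^ 3)) = (1 - q ^ Suc r) * \<phi>"
    using d_flat_shifted[of q a b c d r] nz' nz[of 2] nz[of 3] q_nonzero ac_generic[of r] bd_generic[of r]
    by (simp only: \<phi>_def h_def W_def \<beta>_def \<kappa>'_def y_def x_def e_def s_def) simp

  have U: "\<beta> * F m (y * q) = h * ((1 - x * q\<^sup>2 * q ^ m) * F m y + \<kappa>' * (1 - q ^ m) * F (m - 1) (y * q))"
    unfolding shift_y h_def using nz[of 2] by simp
  have step: "W * F (Suc m) y =
      W * h * (1 - x * q\<^sup>2 * q ^ m) * F m y + \<phi> * (1 - q ^ m) * F (m - 1) (y * q)"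
    unfolding shift_y_Suc U \<phi>_def
    by (simp add: algebra_simps)

  have MR: "R * (1 - q ^ Suc m) = M * (1 - s * q)"
    unfolding R_def M_def sq[symmetric] by (rule q_int_cross)
  have z_term: "R * F (Suc m) z * ((1 - x * q ^ Suc m) * (1 - x * q\<^sup>2 * q ^ m)) / ((1 - x) * (1 - x * q))
    = R * (1 - x * q\<^sup>2 * q ^ m) / (1 - x * q) * F (Suc m) y
      - M * ((1 - s * q) * \<kappa> / ((1 - x) * (1 - x * q))) * (1 - x * q\<^sup>2 * q ^ m) * F m y"
  proof -
    have "R * F (Suc m) z * ((1 - x * q ^ Suc m) * (1 - x * q\<^sup>2 * q ^ m))
      = R * (1 - x * q\<^sup>2 * q ^ m) * ((1 - x * q ^ Suc m) * F (Suc m) z)" by (simp only: mult_ac)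
    also have "\<dots> = (1 - x * q\<^sup>2 * q ^ m) * ((1 - x) * R * F (Suc m) y - R * (1 - q ^ Suc m) * \<kappa> * F m y)"
      unfolding shift_z by (simp add: algebra_simps)
    also have "\<dots> = (1 - x) * (R * (1 - x * q\<^sup>2 * q ^ m) * F (Suc m) y)
        - M * (1 - s * q) * \<kappa> * (1 - x * q\<^sup>2 * q ^ m) * F m y"
      unfolding MR by (simp add: algebra_simps)
    finally show ?thesis using nz' by (simp add: diff_divide_distrib)
  qed
  have MRW: "R * (1 - x * q\<^sup>2 * q ^ m) / (1 - x * q) + M * W = q_int q (Suc m + r)"
  proof -
    have 1: "q_int q (Suc m + r) = M + q ^ Suc m * R"
      unfolding M_def R_def by (rule q_int_add)
    have 2: "M + q ^ Suc m * R = R + s * q * M"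
      using MR by (simp add: algebra_simps)
    have "q_int q (Suc m + r) * (1 - x * q) = (R + s * q * M) - x * q * (M + q ^ Suc m * R)"
      unfolding 1 by (subst 2[symmetric]) (simp add: algebra_simps)
    also have "\<dots> = R * (1 - x * q\<^sup>2 * q ^ m) + M * (s * q * (1 - s * e))"
      by (simp add: x_def algebra_simps power2_eq_square)
    finally show ?thesis
      using nz' unfolding W_def times_divide_eq_right add_divide_distrib[symmetric]
      by (simp only: divide_eq_eq if_True if_False simp_thms)
  qed

  have contiguous: "q_int q (Suc m + r) * F (Suc m) y =
      R * F (Suc m) z * ((1 - x * q ^ Suc m) * (1 - x * q\<^sup>2 * q ^ m)) / ((1 - x) * (1 - x * q))
      + M * (N * (1 - x * q\<^sup>2 * q ^ m) * F m y) + M * (\<phi> * (1 - q ^ m) * F (m - 1) (y * q))"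
    unfolding z_term nat MRW[symmetric] distrib_right mult.assoc[of M W] step
    by (simp add: algebra_simps)

  have q2r: "a * b * c * d * q ^ (2 * r) = x * q\<^sup>2"
    by (simp add: x_sq sq power_mult mult.commute[of 2])
  have T1: "walk_sum (Suc m) r = C / (M * D) * (q_int q (Suc m + r) * F (Suc m) y)"
  proof -
    have "q_binomial q (Suc m + r) r = C * q_int q (Suc m + r) / M"
      unfolding C_def M_def by (rule q_binomial_Suc_top) (rule q_int_nonzero)
    then show ?thesis
      unfolding walk_sum_def q2r D_def by (simp add: sq y_def mult.assoc)
  qed
  have T2: "(if r = 0 then 0 else walk_sum (Suc m) (r - 1)) = C / (M * D) *
      (R * F (Suc m) z * ((1 - x * q ^ Suc m) * (1 - x * q\<^sup>2 * q ^ m)) / ((1 - x) * (1 - x * q)))"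
  proof (cases r)
    case 0
    then show ?thesis by (simp add: R_def q_int_def)
  next
    case (Suc k)
    have s: "s = q ^ k" by (simp add: s_def Suc)
    have "C * R = q_binomial q (Suc m + k) k * M"
      unfolding C_def R_def M_def Suc using q_binomial_Suc_bottom[OF q_int_nonzero, of m k] by simp
    then have C: "q_binomial q (Suc m + k) k = C * R / M" using M0 by (simp add: eq_divide_eq)
    have "poch (Suc m) x * ((1 - x * q ^ Suc m) * (1 - x * q\<^sup>2 * q ^ m)) = poch (Suc (Suc (Suc m))) x"
      by (simp add: poch_def power2_eq_square mult.assoc)
    also have "\<dots> = (1 - x) * (1 - x * q) * D"
      unfolding poch_def D_def by (rule prod_shift_two)
    finally have "poch (Suc m) x = (1 - x) * (1 - x * q) * D / ((1 - x * q ^ Suc m) * (1 - x * q\<^sup>2 * q ^ m))"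
      using nz[of "Suc m"] nz_top by (simp add: eq_divide_eq)
    moreover have "walk_sum (Suc m) k = C * R / M * F (Suc m) z / poch (Suc m) x"
      unfolding walk_sum_def C by (simp add: z_def x_def e_def s power_mult mult.commute[of 2])
    ultimately show ?thesis by (simp add: Suc mult_ac)
  qed
  have T3: "N * walk_sum m r = C / (M * D) * (M * (N * (1 - x * q\<^sup>2 * q ^ m) * F m y))"
  proof -
    have "D = poch m (x * q\<^sup>2) * (1 - x * q\<^sup>2 * q ^ m)" by (simp add: D_def poch_def)
    then show ?thesis
      using M0 nz_top unfolding walk_sum_def q2r C_def[symmetric]
      by (simp add: sq y_def mult.assoc)
  qed
  have T4: "(if m = 0 then 0 else d_flat a b c d q r * walk_sum (m - 1) (Suc r))
     = C / (M * D) * (M * (\<phi> * (1 - q ^ m) * F (m - 1) (y * q)))"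
  proof (cases m)
    case 0
    then show ?thesis by simp
  next
    case (Suc n)
    have "(1 - q ^ Suc r) * q_binomial q (m + r) (Suc r)
      = (1 - q) * (q_binomial q (Suc n + r) (Suc r) * q_int q (Suc r))"
      by (simp only: q_int_mult[symmetric] Suc mult_ac)
    also have "\<dots> = C * (1 - q ^ m)"
      by (subst q_binomial_Suc_bottom)
        (simp_all only: q_int_nonzero C_def Suc q_int_mult[symmetric] mult_ac not_False_eq_True)
    finally have C: "(1 - q ^ Suc r) * q_binomial q (m + r) (Suc r) = C * (1 - q ^ m)" .
    have D: "D = (1 - x * q\<^sup>2) * (1 - x * q ^ 3) * poch n (x * q ^ 4)"
      unfolding D_def Suc poch_def prod_shift_two
      by (simp add: mult.assoc power2_eq_square power3_eq_cube power4_eq_xxxx)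
    have q2r': "a * b * c * d * q ^ (2 * Suc r) = x * q ^ 4"
      using q2r by (simp add: power2_eq_square power4_eq_xxxx mult_ac)
    have "walk_sum n (Suc r) = q_binomial q (m + r) (Suc r) * F n (y * q) / poch n (x * q ^ 4)"
      unfolding walk_sum_def q2r' by (simp add: Suc sq y_def mult_ac)
    also have "\<dots> = ((1 - x * q\<^sup>2) * (1 - x * q ^ 3)) * (q_binomial q (m + r) (Suc r) * F n (y * q) / D)"
      unfolding D using nz[of 2] nz[of 3] by simp
    finally have "d_flat a b c d q r * walk_sum n (Suc r)
      = d_flat a b c d q r * ((1 - x * q\<^sup>2) * (1 - x * q ^ 3))
        * (q_binomial q (m + r) (Suc r) * F n (y * q) / D)"
      by (simp only: mult.assoc)
    also have "\<dots> = (1 - q ^ Suc r) * q_binomial q (m + r) (Suc r) * (\<phi> * F n (y * q) / D)"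
      unfolding flat by (simp only: mult_ac times_divide_eq_right)
    also have "\<dots> = C / (M * D) * (M * (\<phi> * (1 - q ^ m) * F n (y * q)))"
      unfolding C using M0 by simp
    finally show ?thesis by (simp add: Suc)
  qed
  show ?thesis
    unfolding T1 T2 T4 N_def[symmetric] T3 contiguous by (simp only: distrib_left)
qed

lemma mat_power_d_matrix_Suc:
  "mat_power (d_matrix a b c d q) (Suc n) 0 r =
    (if r = 0 then 0 else mat_power (d_matrix a b c d q) n 0 (r - 1))
    + d_natural a b c d q r * mat_power (d_matrix a b c d q) n 0 r
    + d_flat a b c d q r * mat_power (d_matrix a b c d q) n 0 (Suc r)"
proof -
  have "mat_power (d_matrix a b c d q) (Suc n) 0 r =
      (\<Sum>k\<in>{r - 1, r, Suc r}. mat_power (d_matrix a b c d q) n 0 k * d_matrix a b c d q k r)"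
    unfolding mat_power.simps mat_mult_def
    by (rule suminf_finite) (auto simp: d_matrix_def)
  also have "\<dots> = (if r = 0 then 0 else mat_power (d_matrix a b c d q) n 0 (r - 1))
    + d_natural a b c d q r * mat_power (d_matrix a b c d q) n 0 r
    + d_flat a b c d q r * mat_power (d_matrix a b c d q) n 0 (Suc r)"
    by (cases r) (simp_all add: d_matrix_def d_sharp_def)
  finally show ?thesis .
qed

lemma mat_power_d_matrix:
  "mat_power (d_matrix a b c d q) n 0 r = (if r \<le> n then walk_sum (n - r) r else 0)"
proof (induction n arbitrary: r)
  case 0
  then show ?case by (simp add: walk_sum_0)
next
  case (Suc n)
  consider "r > Suc n" | "r = Suc n" | m where "n = m + r"
    by (metis le_add_diff_inverse2 le_Suc_eq not_le)
  then show ?case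
  proof cases
    case 1
    then show ?thesis unfolding mat_power_d_matrix_Suc Suc by auto
  next
    case 2
    then show ?thesis unfolding mat_power_d_matrix_Suc Suc by (simp add: walk_sum_0)
  next
    case 3
    have "m + r - Suc r = m - 1" "Suc r \<le> m + r \<longleftrightarrow> m \<noteq> 0" by auto
    moreover have "r - 1 \<le> m + r" "r \<noteq> 0 \<Longrightarrow> m + r - (r - 1) = Suc m" "Suc (m + r) - r = Suc m" by auto
    ultimately show ?thesis
      unfolding 3 mat_power_d_matrix_Suc Suc.IH[unfolded 3] by (simp add: walk_sum_rec[of m r])
  qed
qed

end

lemma bra_W_ket_V: "bra_mat_ket bra_W A (ket_V r) = A 0 r"
proof -
  have "(\<Sum>j. bra_W i * A i j * ket_V r j) = bra_W i * A i r" for i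
    using suminf_finite[of "{r}" "\<lambda>j. bra_W i * A i j * ket_V r j"] by (simp add: ket_V_def)
  moreover have "(\<Sum>i. bra_W i * A i r) = A 0 r"
    using suminf_finite[of "{0}" "\<lambda>i. bra_W i * A i r"] by (simp add: bra_W_def)
  ultimately show ?thesis by (simp add: bra_mat_ket_def)
qed

theorem theorem7p13:
  fixes a b c d q :: complex and m r :: nat
  assumes "q \<noteq> 0"
    and "\<And>j::nat. j \<ge> 1 \<Longrightarrow> q_int q j \<noteq> 0"
    and "\<And>k::int. k \<ge> -2 \<Longrightarrow> 1 - q powi k * (a*b*c*d) \<noteq> 0"
    and "\<And>n::nat. 1 - q^n * (a*c) \<noteq> 0"
    and "\<And>n::nat. 1 - q^n * (b*d) \<noteq> 0"
  shows "bra_mat_ket bra_W (mat_power (d_matrix a b c d q) (m + r)) (ket_V r)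
    = q_binomial q (m + r) r * F_poly a b c d q (int m) (b * d * q^r)
      / (\<Prod>i<m. 1 - a*b*c*d * q^(2*r+i))"
proof -
  interpret generic_parameters a b c d q
    using assms by unfold_locales
  show ?thesis
    by (simp add: bra_W_ket_V mat_power_d_matrix walk_sum_def poch_def power_add mult.assoc)
qed

end
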